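(* Let $k\ge2$, $\lambda\in(0,1/2)$, $n\in\mathbb N$, and let $\hat\mu$ be an estimator for the first-price auction model with $k$ bidders based on $n$ samples. Then for all $\delta>0$ there exists a first-price auction model characterized by a tuple of bid distributions $\mathcal D=\{f_i\}_{i=1}^k$ on $[0,1]$, whose CDFs $F_i$ satisfy $|F_i(x)-F_i(y)|\ge\lambda|x-y|$ for all $x,y\in[0,1]$ and $i\in\{1,\dots,k\}$, such that $$\mathbb P\left(d_{\mathrm K}\big(\hat\mu(\mathbf W),\mathcal D\big)\le\frac14\right)\ \le\ \frac12+\delta,$$ where $\mathbf W=\{(Y_j,Z_j)\}_{j=1}^n$ are drawn i.i.d. from the first-price auction model on $\mathcal D$.
   Context: First-price auction data: a sample $(Y,Z)$ from the first-price auction with bid distributions given by a $k$-tuple of distributions on $[0,1]$ is generated by drawing $X_i$ from the $i$-th distribution, independently for $i\in[k]=\{1,\dots,k\}$, and observing $(Y,Z)=(\max_{i\in[k]}X_i,\ \arg\max_{i\in[k]}X_i)$. Estimator: a map $\hat\mu$ taking $n$ observed samples to a $k$-tuple of distributions on $[0,1]$. Kolmogorov distance: for distributions $P,Q$ on $[0,1]$ with CDFs $F_P,F_Q$, $d_{\mathrm K}(P,Q)=\sup_{x\in[0,1]}|F_P(x)-F_Q(x)|$. For $k$-tuples of distributions, $d_{\mathrm K}$ denotes the maximum over $i\in[k]$ of the Kolmogorov distances between $i$-th components. *)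

theory Defs
  imports "HOL-Probability.Probability"
begin

text \<open>
  Probability distributions on $[0,1]$, represented as Borel measures on the real line that are
  carried by $[0,1]$, so that the library function \<^const>\<open>cdf\<close> applies. The sigma-algebra on the set
  of distributions is the one generated by the evaluations on Borel sets.
\<close>

definition unit_distributions :: "real measure measure" where
  "unit_distributions = restrict_space (prob_algebra borel) {P. measure P {0..1} = 1}"

definition kolmogorov_dist :: "real measure \<Rightarrow> real measure \<Rightarrow> real" where
  "kolmogorov_dist P Q = (SUP x\<in>{0..1}. \<bar>cdf P x - cdf Q x\<bar>)"

definition tuple_kolmogorov_dist ::
    "nat \<Rightarrow> (nat \<Rightarrow> real measure) \<Rightarrow> (nat \<Rightarrow> real measure) \<Rightarrow> real" where
  "tuple_kolmogorov_dist k P Q = (MAX i\<in>{1..k}. kolmogorov_dist (P i) (Q i))"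

text \<open>
  The space of observed pairs $(Y,Z)$. The first coordinate is allowed to range over all reals; an
  observation lies in $[0,1]$ almost surely, and a measurable map defined on samples with values in
  $[0,1]$ extends measurably to all samples.
\<close>

definition observation_space :: "nat \<Rightarrow> (real \<times> nat) measure" where
  "observation_space k = borel \<Otimes>\<^sub>M count_space {1..k}"

text \<open>
  Ties are resolved by the unspecified choice built into \<^const>\<open>arg_max_on\<close>; it is a function
  of the set of maximisers only.
\<close>

definition observation :: "nat \<Rightarrow> (nat \<Rightarrow> real) \<Rightarrow> real \<times> nat" where
  "observation k x = ((MAX i\<in>{1..k}. x i), arg_max_on x {1..k})"

definition first_price_auction :: "nat \<Rightarrow> (nat \<Rightarrow> real measure) \<Rightarrow> (real \<times> nat) measure" where
  "first_price_auction k D =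
     distr (\<Pi>\<^sub>M i\<in>{1..k}. D i) (observation_space k) (observation k)"

definition auction_samples ::
    "nat \<Rightarrow> nat \<Rightarrow> (nat \<Rightarrow> real measure) \<Rightarrow> (nat \<Rightarrow> real \<times> nat) measure" where
  "auction_samples k n D = (\<Pi>\<^sub>M j\<in>{1..n}. first_price_auction k D)"

text \<open>
  Measurability is part of the notion of an estimator: it makes the event that the estimate lies
  within a given Kolmogorov distance of a fixed tuple measurable.
\<close>

definition estimators ::
    "nat \<Rightarrow> nat \<Rightarrow> ((nat \<Rightarrow> real \<times> nat) \<Rightarrow> nat \<Rightarrow> real measure) set" where
  "estimators k n =
     (\<Pi>\<^sub>M j\<in>{1..n}. observation_space k) \<rightarrow>\<^sub>M (\<Pi>\<^sub>M i\<in>{1..k}. unit_distributions)"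

end

theory Submission imports Defs
begin

text \<open>
  The other bidders hide the low bids of bidder 1. Let every bidder bid uniformly on $[0,1]$ with
  probability $\lambda$; with the remaining probability $1-\lambda$, bidder 1 bids $a$ and all others
  bid 1. Between $a = 0$ and $a = \varepsilon$ the CDF of bidder 1 changes by $1-\lambda > 1/2$ at 0,
  so no estimate is within $1/4$ of both models. Driving both models by the same uniform variables,
  an observation can differ only if bidder 2 bids at most $\varepsilon$, so the two samples coincide
  except with probability at most $n\lambda\varepsilon$.
\<close>

section \<open>Push-forwards of finite product measures\<close>

text \<open>A product measure is determined by its values on boxes, and the preimage of a box under
  a componentwise map is again a box. This lets models with different bid distributions be driven by
  one product of uniform variables.\<close>

lemma PiM_distr_finite:
  assumes "finite I" and M: "\<And>i. prob_space (M i)"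
    and f[measurable]: "\<And>i. f i \<in> M i \<rightarrow>\<^sub>M N i"
  shows "(\<Pi>\<^sub>M i\<in>I. distr (M i) (N i) (f i)) =
    distr (PiM I M) (PiM I N) (\<lambda>x. \<lambda>i\<in>I. f i (x i))"
proof -
  interpret M: product_prob_space M by (rule product_prob_spaceI) (rule M)
  interpret D: product_prob_space "\<lambda>i. distr (M i) (N i) (f i)"
    by (rule product_prob_spaceI) (intro prob_space.prob_space_distr M f)
  have sets_eq: "sets (\<Pi>\<^sub>M i\<in>I. distr (M i) (N i) (f i)) = sets (PiM I N)"
    by (intro sets_PiM_cong) auto
  show ?thesis
  proof (rule D.PiM_eqI[OF \<open>finite I\<close>, symmetric])
    fix A assume A: "\<And>i. i \<in> I \<Longrightarrow> A i \<in> sets (distr (M i) (N i) (f i))"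
    then have [measurable]: "\<And>i. i \<in> I \<Longrightarrow> A i \<in> sets (N i)"
      by simp
    have "emeasure (distr (PiM I M) (PiM I N) (\<lambda>x. \<lambda>i\<in>I. f i (x i))) (Pi\<^sub>E I A) =
        emeasure (PiM I M) ((\<lambda>x. \<lambda>i\<in>I. f i (x i)) -` Pi\<^sub>E I A \<inter> space (PiM I M))"
      using \<open>finite I\<close> by (intro emeasure_distr sets_PiM_I_finite) auto
    also have "(\<lambda>x. \<lambda>i\<in>I. f i (x i)) -` Pi\<^sub>E I A \<inter> space (PiM I M) =
        (\<Pi>\<^sub>E i\<in>I. f i -` A i \<inter> space (M i))"
      by (auto simp: space_PiM PiE_iff restrict_def extensional_def)
    also have "emeasure (PiM I M) \<dots> = (\<Prod>i\<in>I. emeasure (M i) (f i -` A i \<inter> space (M i)))"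
      using \<open>finite I\<close> by (intro M.emeasure_PiM) auto
    also have "\<dots> = (\<Prod>i\<in>I. emeasure (distr (M i) (N i) (f i)) (A i))"
      by (intro prod.cong refl emeasure_distr[symmetric]) auto
    finally show "emeasure (distr (PiM I M) (PiM I N) (\<lambda>x. \<lambda>i\<in>I. f i (x i))) (Pi\<^sub>E I A) =
      (\<Prod>i\<in>I. emeasure (distr (M i) (N i) (f i)) (A i))" .
  qed (simp add: sets_eq)
qed

section \<open>Measurability of the observation, and its insensitivity to losing bids\<close>

text \<open>The index depends on the bids only through the set of maximisers. That set takes
  finitely many values, and each of them is taken on an event cut out by finitely many comparisons
  of coordinates.\<close>

lemma measurable_arg_max_on:
  "(\<lambda>x. arg_max_on x {1..k}) \<in> (\<Pi>\<^sub>M i\<in>{1..k::nat}. borel :: real measure) \<rightarrow>\<^sub>M count_space UNIV"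
proof -
  let ?M = "\<Pi>\<^sub>M i\<in>{1..k}. borel :: real measure"
  let ?A = "\<lambda>x. {i \<in> {1..k}. \<forall>j\<in>{1..k}. x j \<le> (x i :: real)}"
  have "?A \<in> ?M \<rightarrow>\<^sub>M count_space (Pow {1..k})"
  proof (subst measurable_count_space_eq2, simp, intro conjI ballI)
    fix S assume "S \<in> Pow {1..k}"
    then have "?A -` {S} \<inter> space ?M =
        {x \<in> space ?M. \<forall>i\<in>{1..k}. i \<in> S \<longleftrightarrow> (\<forall>j\<in>{1..k}. x j \<le> x i)}"
      by blast
    also have "\<dots> \<in> sets ?M"
    proof -
      have [measurable]: "Measurable.pred ?M (\<lambda>x. x j \<le> x i)" if "i \<in> {1..k}" "j \<in> {1..k}" for i j
        unfolding pred_def using that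
        by (intro borel_measurable_le measurable_component_singleton)
      show ?thesis by measurable
    qed
    finally show "?A -` {S} \<inter> space ?M \<in> sets ?M" .
  qed auto
  \<comment> \<open>Every map out of a discrete space is measurable, so nothing has to be known
    about the choice operator.\<close>
  then have "(\<lambda>x. (\<lambda>S. SOME i. i \<in> S) (?A x)) \<in> ?M \<rightarrow>\<^sub>M count_space UNIV"
    by (rule measurable_compose) simp
  also have "(\<lambda>x. (\<lambda>S. SOME i. i \<in> S) (?A x)) = (\<lambda>x. arg_max_on x {1..k})"
    unfolding arg_max_on_def arg_max_def is_arg_max_linorder by (simp add: Ball_def)
  finally show ?thesis .
qed

lemma arg_max_on_in:
  fixes f :: "'a \<Rightarrow> 'b::linorder"
  assumes "finite S" "S \<noteq> {}"
  shows "arg_max_on f S \<in> S"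
proof -
  have "Max (f ` S) \<in> f ` S" using assms by (intro Max_in) auto
  then obtain i where "i \<in> S" "f i = Max (f ` S)" by auto
  then have "is_arg_max f (\<lambda>x. x \<in> S) i"
    using assms by (auto simp: is_arg_max_linorder)
  then have "is_arg_max f (\<lambda>x. x \<in> S) (arg_max_on f S)"
    unfolding arg_max_on_def arg_max_def by (rule someI)
  then show ?thesis by (simp add: is_arg_max_def)
qed

lemma measurable_observation:
  assumes "1 \<le> k"
  shows "observation k \<in> (\<Pi>\<^sub>M i\<in>{1..k}. borel) \<rightarrow>\<^sub>M observation_space k"
proof -
  \<comment> \<open>Shrinking the codomain to \<open>{1..k}\<close> requires the chosen index to lie
    there; this is where \<open>1 \<le> k\<close> enters, as it makes the set of bidders
    nonempty.\<close>
  have "(\<lambda>x. arg_max_on x {1..k}) \<in> (\<Pi>\<^sub>M i\<in>{1..k}. borel :: real measure) \<rightarrow>\<^sub>M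
      restrict_space (count_space UNIV) {1..k}"
    using assms by (intro measurable_restrict_space2 measurable_arg_max_on funcsetI arg_max_on_in) auto
  then have [measurable]: "(\<lambda>x. arg_max_on x {1..k}) \<in>
      (\<Pi>\<^sub>M i\<in>{1..k}. borel :: real measure) \<rightarrow>\<^sub>M count_space {1..k}"
    by (simp add: restrict_count_space)
  have [measurable]: "(\<lambda>x. MAX i\<in>{1..k}. x i) \<in> borel_measurable (\<Pi>\<^sub>M i\<in>{1..k}. borel :: real measure)"
    by (rule borel_measurable_Max) auto
  show ?thesis
    unfolding observation_space_def observation_def by measurable
qed

text \<open>Since \<open>b\<close> strictly outbids \<open>a\<close> in both profiles, the bid of
  \<open>a\<close> affects neither the maximum nor the set of maximisers.\<close>

lemma observation_cong_losing_bid: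
  assumes "a \<in> {1..k}" "b \<in> {1..k}"
    and eq: "\<And>i. i \<in> {1..k} \<Longrightarrow> i \<noteq> a \<Longrightarrow> x i = y i"
    and "x a < x b" "y a < y b"
  shows "observation k x = observation k y"
proof -
  have aux: "(MAX i\<in>{1..k}. z i) = (MAX i\<in>{1..k} - {a}. z i)" if "z a < z b" for z :: "nat \<Rightarrow> real"
  proof -
    have "b \<in> {1..k} - {a}" using that assms by auto
    then have "z b \<le> (MAX i\<in>{1..k} - {a}. z i)" "z ` ({1..k} - {a}) \<noteq> {}"
      by (blast intro: Max_ge finite_imageI)+
    with that have "z a \<le> (MAX i\<in>{1..k} - {a}. z i)" "z ` ({1..k} - {a}) \<noteq> {}"
      by linarith+
    then have "Max (insert (z a) (z ` ({1..k} - {a}))) = (MAX i\<in>{1..k} - {a}. z i)"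
      by (subst Max_insert) (auto simp: max_def)
    moreover have "insert (z a) (z ` ({1..k} - {a})) = z ` {1..k}"
      using assms by auto
    ultimately show ?thesis by simp
  qed
  have arg: "is_arg_max z (\<lambda>i. i \<in> {1..k}) i \<longleftrightarrow>
      i \<in> {1..k} - {a} \<and> (\<forall>j\<in>{1..k} - {a}. z j \<le> z i)" if "z a < z b" for z :: "nat \<Rightarrow> real" and i
  proof -
    have "b \<in> {1..k} - {a}" using that assms by auto
    then show ?thesis
      using that unfolding is_arg_max_linorder
      by (smt (verit) DiffE DiffI assms(1) insertCI singletonD)
  qed
  \<comment> \<open>Equality of the predicates themselves is what is needed: the choice operator
    then returns the same index, however it resolves ties.\<close>
  have "is_arg_max x (\<lambda>i. i \<in> {1..k}) = is_arg_max y (\<lambda>i. i \<in> {1..k})"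
    unfolding arg[OF \<open>x a < x b\<close>, abs_def] arg[OF \<open>y a < y b\<close>, abs_def] fun_eq_iff
    using eq by auto
  moreover have "x ` ({1..k} - {a}) = y ` ({1..k} - {a})"
    using eq by (intro image_cong) auto
  ultimately show ?thesis
    unfolding observation_def arg_max_on_def arg_max_def aux[OF \<open>x a < x b\<close>] aux[OF \<open>y a < y b\<close>]
    by (simp only:)
qed

section \<open>Mixtures of a uniform law and a point mass\<close>

abbreviation uniform_unit :: "real measure" where
  "uniform_unit \<equiv> uniform_measure lborel {0..1}"

lemma prob_space_uniform_unit: "prob_space uniform_unit"
  by (rule prob_space_uniform_measure) auto

lemma measure_uniform_unit:
  assumes "A \<in> sets borel"
  shows "measure uniform_unit A = measure lborel ({0..1} \<inter> A)"
  using assms by (subst measure_uniform_measure) auto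

text \<open>Turns a uniform variable into one whose law is the mixture of the uniform distribution, with
  weight \<open>lam\<close>, and the point mass at \<open>a\<close>.\<close>

definition bid :: "real \<Rightarrow> real \<Rightarrow> real \<Rightarrow> real" where
  "bid lam a u = (if u < lam then u / lam else a)"

lemma measurable_bid[measurable]: "bid lam a \<in> borel_measurable borel"
  unfolding bid_def by measurable

definition bid_dist :: "real \<Rightarrow> real \<Rightarrow> real measure" where
  "bid_dist lam a = distr uniform_unit borel (bid lam a)"

lemma sets_bid_dist[simp, measurable_cong]: "sets (bid_dist lam a) = sets borel"
  by (simp add: bid_dist_def)

lemma prob_space_bid_dist: "prob_space (bid_dist lam a)"
  unfolding bid_dist_def
  by (rule prob_space.prob_space_distr[OF prob_space_uniform_unit]) simp

lemma measure_bid_dist: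
  assumes "A \<in> sets borel"
  shows "measure (bid_dist lam a) A = measure lborel ({0..1} \<inter> bid lam a -` A)"
proof -
  have "bid lam a -` A \<in> sets borel"
    using measurable_sets[OF measurable_bid assms] by simp
  then show ?thesis
    using assms unfolding bid_dist_def
    by (subst measure_distr) (auto simp: measure_uniform_unit)
qed

lemma bid_dist_in_unit_distributions:
  assumes "0 < lam" "a \<in> {0..1}"
  shows "bid_dist lam a \<in> space unit_distributions"
proof -
  have "{0..1} \<inter> bid lam a -` {0..1} = {0..1::real}"
    using assms by (auto simp: bid_def)
  then show ?thesis
    by (auto simp: unit_distributions_def space_restrict_space space_prob_algebra
        prob_space_bid_dist measure_bid_dist)
qed

text \<open>The uniform component alone provides the growth: seeds between \<open>lam * x\<close>
  and \<open>lam * y\<close> are sent to bids between \<open>x\<close> and \<open>y\<close>. The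
  point mass can only increase the difference.\<close>

lemma cdf_bid_dist_diff:
  assumes "0 < lam" "lam \<le> 1" "0 \<le> x" "x \<le> y" "y \<le> 1"
  shows "lam * (y - x) \<le> cdf (bid_dist lam a) y - cdf (bid_dist lam a) x"
proof -
  interpret prob_space "bid_dist lam a" by (rule prob_space_bid_dist)
  interpret finite_borel_measure "bid_dist lam a" by standard simp
  show ?thesis
  proof (cases "x < y")
    case True
    have "lam * x \<le> lam * y" using assms by (intro mult_left_mono) auto
    \<comment> \<open>The interval is open because for \<open>y = 1\<close> its right end is
      \<open>lam\<close>, which \<open>bid\<close> sends to the point mass; the length is
      unaffected.\<close>
    then have "lam * (y - x) = measure lborel {lam * x<..<lam * y}"
      by (simp add: algebra_simps)
    also have "\<dots> \<le> measure lborel ({0..1} \<inter> bid lam a -` {x<..y})"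
    proof (rule measure_mono_fmeasurable)
      have "u < lam" "u \<in> {0..1}" if "u \<in> {lam * x<..<lam * y}" for u
      proof -
        have "lam * y \<le> lam" "0 \<le> lam * x" using assms by (auto simp: mult_left_le)
        moreover have "lam * x < u" "u < lam * y" using that by auto
        ultimately have "u < lam" "0 \<le> u" "u \<le> 1" using assms by linarith+
        then show "u < lam" "u \<in> {0..1}" by auto
      qed
      then show "{lam * x<..<lam * y} \<subseteq> {0..1} \<inter> bid lam a -` {x<..y}"
        using assms by (fastforce simp: bid_def field_simps)
      have "bid lam a -` {x<..y} \<in> sets borel"
        using measurable_sets[OF measurable_bid, of "{x<..y}"] by simp
      then show "{0..1} \<inter> bid lam a -` {x<..y} \<in> fmeasurable lborel"
        by (intro fmeasurable_Int_fmeasurable fmeasurable_compact) auto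
    qed simp
    also have "\<dots> = cdf (bid_dist lam a) y - cdf (bid_dist lam a) x"
      by (simp add: cdf_diff_eq True measure_bid_dist)
    finally show ?thesis .
  qed (use assms in auto)
qed

text \<open>With the atom at 0, all seeds from \<open>lam\<close> to 1 give the bid 0. With the atom
  at \<open>e > 0\<close>, only the seed 0 gives a bid of at most 0, and it has measure
  zero.\<close>

lemma cdf_bid_dist_point_mass:
  assumes "0 < lam" "lam \<le> 1" "0 < e"
  shows "1 - lam \<le> cdf (bid_dist lam 0) 0 - cdf (bid_dist lam e) 0"
proof -
  have "bid lam 0 -` {..0} = {..0} \<union> {lam..}" "{0..1} \<inter> bid lam e -` {..0} = {0}"
    using assms by (auto simp: bid_def field_simps split: if_splits)
  moreover have "measure lborel {lam..1} \<le> measure lborel ({0..1} \<inter> ({..0} \<union> {lam..}))"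
    using assms by (intro measure_mono_fmeasurable fmeasurable_Int_fmeasurable fmeasurable_compact) auto
  ultimately show ?thesis
    using assms by (simp add: cdf_def measure_bid_dist)
qed

section \<open>Lower bounds on the Kolmogorov distance\<close>

text \<open>A real supremum dominates its members once the family is bounded above; differences of
  two probabilities are bounded by 1.\<close>

lemma cdf_diff_le_kolmogorov_dist:
  assumes "prob_space P" "prob_space Q" "sets P = sets borel" "sets Q = sets borel" "x \<in> {0..1}"
  shows "\<bar>cdf P x - cdf Q x\<bar> \<le> kolmogorov_dist P Q"
proof -
  interpret P: prob_space P by fact
  interpret Q: prob_space Q by fact
  have "\<bar>cdf P z - cdf Q z\<bar> \<le> 1" for z
    using P.prob_le_1[of "{..z}"] Q.prob_le_1[of "{..z}"]
      measure_nonneg[of P "{..z}"] measure_nonneg[of Q "{..z}"]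
    unfolding cdf_def by linarith
  then have "bdd_above ((\<lambda>z. \<bar>cdf P z - cdf Q z\<bar>) ` {0..1})"
    by (intro bdd_aboveI[of _ 1]) auto
  then show ?thesis
    unfolding kolmogorov_dist_def using assms by (intro cSUP_upper)
qed

lemma cdf_diff_le_tuple_kolmogorov_dist:
  assumes "i \<in> {1..k}" "P i \<in> space unit_distributions" "Q i \<in> space unit_distributions"
    and "x \<in> {0..1}"
  shows "\<bar>cdf (P i) x - cdf (Q i) x\<bar> \<le> tuple_kolmogorov_dist k P Q"
proof -
  have "\<bar>cdf (P i) x - cdf (Q i) x\<bar> \<le> kolmogorov_dist (P i) (Q i)"
    using assms by (intro cdf_diff_le_kolmogorov_dist)
      (auto simp: unit_distributions_def space_restrict_space space_prob_algebra)
  also have "\<dots> \<le> tuple_kolmogorov_dist k P Q"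
    unfolding tuple_kolmogorov_dist_def using assms by (intro Max_ge) auto
  finally show ?thesis .
qed

section \<open>The two models and their coupling\<close>

definition hidden_bid_model :: "real \<Rightarrow> real \<Rightarrow> nat \<Rightarrow> real measure" where
  "hidden_bid_model lam a i = bid_dist lam (if i = 1 then a else 1)"

text \<open>One round as a function of the seeds \<open>u\<close>. The law of \<open>u\<close> does
  not involve \<open>a\<close>, so feeding the same \<open>u\<close> to two values of
  \<open>a\<close> couples the two models.\<close>

definition hidden_observation :: "nat \<Rightarrow> real \<Rightarrow> real \<Rightarrow> (nat \<Rightarrow> real) \<Rightarrow> real \<times> nat" where
  "hidden_observation k lam a u =
     observation k (\<lambda>i\<in>{1..k}. bid lam (if i = 1 then a else 1) (u i))"

lemma measurable_hidden_observation:
  assumes "1 \<le> k"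
  shows "hidden_observation k lam a \<in> (\<Pi>\<^sub>M i\<in>{1..k}. uniform_unit) \<rightarrow>\<^sub>M observation_space k"
proof -
  have [measurable]: "bid lam b \<in> uniform_unit \<rightarrow>\<^sub>M borel" for b
    by simp
  have "(\<lambda>u. \<lambda>i\<in>{1..k}. bid lam (if i = 1 then a else 1) (u i)) \<in>
      (\<Pi>\<^sub>M i\<in>{1..k}. uniform_unit) \<rightarrow>\<^sub>M (\<Pi>\<^sub>M i\<in>{1..k}. borel)"
    by measurable
  from measurable_compose[OF this measurable_observation[OF assms]]
  show ?thesis unfolding hidden_observation_def .
qed

lemma first_price_auction_hidden_bid_model:
  assumes "1 \<le> k"
  shows "first_price_auction k (hidden_bid_model lam a) =
    distr (\<Pi>\<^sub>M i\<in>{1..k}. uniform_unit) (observation_space k) (hidden_observation k lam a)"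
proof -
  have "(\<Pi>\<^sub>M i\<in>{1..k}. hidden_bid_model lam a i) =
    distr (\<Pi>\<^sub>M i\<in>{1..k}. uniform_unit) (\<Pi>\<^sub>M i\<in>{1..k}. borel)
      (\<lambda>u. \<lambda>i\<in>{1..k}. bid lam (if i = 1 then a else 1) (u i))"
    unfolding hidden_bid_model_def bid_dist_def
    by (rule PiM_distr_finite) (auto simp: prob_space_uniform_unit)
  then show ?thesis
    unfolding first_price_auction_def
    by (simp only:) (subst distr_distr, rule measurable_observation[OF assms],
        auto simp: hidden_observation_def comp_def intro!: arg_cong[where f="distr _ _"])
qed

text \<open>Push-forward is applied to the bidders within a round and then to the rounds. The
  samples for all \<open>a\<close> thus live on one probability space, and \<open>a\<close> enters
  only through the map.\<close>

lemma auction_samples_hidden_bid_model: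
  assumes "1 \<le> k"
  shows "auction_samples k n (hidden_bid_model lam a) =
    distr (\<Pi>\<^sub>M j\<in>{1..n}. \<Pi>\<^sub>M i\<in>{1..k}. uniform_unit) (\<Pi>\<^sub>M j\<in>{1..n}. observation_space k)
      (\<lambda>\<omega>. \<lambda>j\<in>{1..n}. hidden_observation k lam a (\<omega> j))"
  unfolding auction_samples_def first_price_auction_hidden_bid_model[OF assms]
  by (intro PiM_distr_finite finite_atLeastAtMost prob_space_PiM prob_space_uniform_unit
      measurable_hidden_observation assms)

text \<open>Either bidder 1 draws from the uniform component, and then the bid does not involve the
  atom, or bidder 1 bids 0 or \<open>e\<close> and loses to bidder 2 in both models.\<close>

lemma hidden_observation_eq:
  assumes "2 \<le> k" "0 < lam" "0 \<le> e" "e < 1" "lam * e < u 2"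
  shows "hidden_observation k lam 0 u = hidden_observation k lam e u"
proof (cases "u 1 < lam")
  case True
  then have "(\<lambda>i\<in>{1..k}. bid lam (if i = 1 then 0 else 1) (u i)) =
      (\<lambda>i\<in>{1..k}. bid lam (if i = 1 then e else 1) (u i))"
    by (auto simp: bid_def)
  then show ?thesis by (simp only: hidden_observation_def)
next
  case False
  \<comment> \<open>Bidder 2 bids \<open>u 2 / lam > e\<close> from the uniform component, or 1,
    which exceeds \<open>e\<close>.\<close>
  have "e < bid lam 1 (u 2)"
    using assms by (auto simp: bid_def field_simps)
  then show ?thesis
    unfolding hidden_observation_def
    using assms False
    by (intro observation_cong_losing_bid[where a=1 and b=2])
      (auto simp: bid_def[of lam _ "u (Suc 0)"])
qed

section \<open>The two-point bound\<close>

lemma (in prob_space) prob_add_le_1_plus: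
  assumes "A \<in> events" "B \<in> events" "E \<in> events" "A \<inter> B \<subseteq> E"
  shows "prob A + prob B \<le> 1 + prob E"
proof -
  have "prob A + prob B = prob (A \<union> B) + prob (A \<inter> B)"
    using assms measure_Un3[of A M B] by (simp add: fmeasurable_eq_sets)
  also have "\<dots> \<le> 1 + prob E"
    using assms by (intro add_mono finite_measure_mono) auto
  finally show ?thesis .
qed

text \<open>Projecting first to round \<open>j\<close> and then to bidder \<open>i\<close> maps the
  nested product to the uniform law.\<close>

lemma prob_small_component:
  assumes "i \<in> I" "j \<in> J" "0 \<le> c" "c \<le> 1"
  shows "measure (\<Pi>\<^sub>M j\<in>J. \<Pi>\<^sub>M i\<in>I. uniform_unit)
    {\<omega> \<in> space (\<Pi>\<^sub>M j\<in>J. \<Pi>\<^sub>M i\<in>I. uniform_unit). \<omega> j i \<le> c} = c"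
proof -
  let ?P = "\<Pi>\<^sub>M i\<in>I. uniform_unit" and ?M = "\<Pi>\<^sub>M j\<in>J. \<Pi>\<^sub>M i\<in>I. uniform_unit"
  have P: "prob_space ?P"
    by (intro prob_space_PiM prob_space_uniform_unit)
  have "distr ?P uniform_unit (\<lambda>u. u i) = uniform_unit"
    using assms(1) by (intro distr_PiM_component prob_space_uniform_unit)
  moreover have "distr ?M ?P (\<lambda>\<omega>. \<omega> j) = ?P"
    using assms(2) P by (intro distr_PiM_component)
  ultimately have eq: "distr ?M uniform_unit (\<lambda>\<omega>. \<omega> j i) = uniform_unit"
    using distr_distr[of "\<lambda>u. u i" ?P uniform_unit "\<lambda>\<omega>. \<omega> j" ?M] assms
    by (simp add: comp_def)
  have [measurable]: "(\<lambda>\<omega>. \<omega> j i) \<in> ?M \<rightarrow>\<^sub>M uniform_unit"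
    using measurable_compose[OF measurable_component_singleton[OF assms(2)]
        measurable_component_singleton[OF assms(1)]] .
  have "measure ?M {\<omega> \<in> space ?M. \<omega> j i \<le> c} = measure (distr ?M uniform_unit (\<lambda>\<omega>. \<omega> j i)) {..c}"
    by (subst measure_distr) (auto intro!: arg_cong[where f="measure ?M"])
  also have "\<dots> = measure lborel ({0..1} \<inter> {..c})"
    by (simp add: eq measure_uniform_unit)
  also have "{0..1} \<inter> {..c} = {0..c}" using assms by auto
  finally show ?thesis using assms by simp
qed

text \<open>Both success events are pulled back to the common seed space. Where the two samples
  coincide, they cannot lie in the disjoint sets \<open>A\<close> and \<open>B\<close> at once, so
  the pulled-back events overlap only where the coupling may fail.\<close>

lemma auction_success_sum:
  fixes lam e :: real
  assumes k: "2 \<le> k" and lam: "0 < lam" "lam \<le> 1" and e: "0 \<le> e" "e < 1"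
    and A: "A \<in> sets (\<Pi>\<^sub>M j\<in>{1..n}. observation_space k)"
    and B: "B \<in> sets (\<Pi>\<^sub>M j\<in>{1..n}. observation_space k)"
    and disj: "A \<inter> B = {}"
  shows "measure (auction_samples k n (hidden_bid_model lam 0)) A +
    measure (auction_samples k n (hidden_bid_model lam e)) B \<le> 1 + n * (lam * e)"
proof -
  let ?M = "\<Pi>\<^sub>M j\<in>{1..n}. \<Pi>\<^sub>M i\<in>{1..k}. uniform_unit"
  let ?S = "\<Pi>\<^sub>M j\<in>{1..n}. observation_space k"
  define h where "h a \<omega> = (\<lambda>j\<in>{1..n}. hidden_observation k lam a (\<omega> j))" for a \<omega>
  \<comment> \<open>In some round the seed of bidder 2 is so low that bidder 1's atom may be
    revealed; the union bound over the rounds gives \<open>n * (lam * e)\<close>.\<close>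
  define E where "E = (\<Union>j\<in>{1..n}. {\<omega> \<in> space ?M. \<omega> j 2 \<le> lam * e})"
  interpret M: prob_space ?M
    by (intro prob_space_PiM prob_space_uniform_unit)
  have [measurable]: "hidden_observation k lam a \<in> (\<Pi>\<^sub>M i\<in>{1..k}. uniform_unit) \<rightarrow>\<^sub>M observation_space k" for a
    using k by (intro measurable_hidden_observation) auto
  have h[measurable]: "h a \<in> ?M \<rightarrow>\<^sub>M ?S" for a
    unfolding h_def by measurable
  have samples: "auction_samples k n (hidden_bid_model lam a) = distr ?M ?S (h a)" for a
    using k unfolding h_def by (intro auction_samples_hidden_bid_model) auto
  have E_sets: "{\<omega> \<in> space ?M. \<omega> j 2 \<le> lam * e} \<in> sets ?M" if "j \<in> {1..n}" for j
  proof -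
    have "(\<lambda>\<omega>. \<omega> j 2) \<in> ?M \<rightarrow>\<^sub>M uniform_unit"
      using that k by (intro measurable_compose[OF measurable_component_singleton[of j]
            measurable_component_singleton[of 2]]) auto
    then have [measurable]: "(\<lambda>\<omega>. \<omega> j 2) \<in> borel_measurable ?M"
      by (simp add: measurable_def)
    show ?thesis by measurable
  qed
  have "lam * e \<le> 1" using lam e by (simp add: mult_le_one)
  then have "M.prob E \<le> (\<Sum>j\<in>{1..n}. lam * e)"
    unfolding E_def using E_sets k lam e
    by (intro order.trans[OF M.finite_measure_subadditive_finite] sum_mono)
      (auto simp: prob_small_component)
  moreover have "h 0 \<omega> = h e \<omega>" if "\<omega> \<in> space ?M - E" for \<omega>
    unfolding h_def
  proof (intro restrict_ext hidden_observation_eq k lam e)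
    fix j assume "j \<in> {1..n}"
    with that show "lam * e < \<omega> j 2" by (auto simp: E_def not_le)
  qed
  then have "(h 0 -` A \<inter> space ?M) \<inter> (h e -` B \<inter> space ?M) \<subseteq> E"
    using disj by fastforce
  then have "M.prob (h 0 -` A \<inter> space ?M) + M.prob (h e -` B \<inter> space ?M) \<le> 1 + M.prob E"
    using E_sets A B
    by (intro M.prob_add_le_1_plus measurable_sets[OF h]) (auto simp: E_def)
  ultimately show ?thesis
    unfolding samples measure_distr[OF h A] measure_distr[OF h B] by simp
qed

section \<open>The lower bound for estimators\<close>

theorem theorem2p7:
  fixes k n :: nat and lam :: real
    and mu :: "(nat \<Rightarrow> real \<times> nat) \<Rightarrow> nat \<Rightarrow> real measure"
  assumes "k \<ge> 2" and "0 < lam" and "lam < 1/2"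
    and "mu \<in> estimators k n"
  shows "\<forall>\<delta>::real. \<delta> > 0 \<longrightarrow>
    (\<exists>D :: nat \<Rightarrow> real measure.
       (\<forall>i\<in>{1..k}. D i \<in> space unit_distributions) \<and>
       (\<forall>i\<in>{1..k}. \<forall>x\<in>{0..1}. \<forall>y\<in>{0..1}.
          \<bar>cdf (D i) x - cdf (D i) y\<bar> \<ge> lam * \<bar>x - y\<bar>) \<and>
       \<P>(w in auction_samples k n D. tuple_kolmogorov_dist k (mu w) D \<le> 1/4) \<le> 1/2 + \<delta>)"
proof (intro allI impI)
  fix \<delta> :: real assume "\<delta> > 0"
  \<comment> \<open>The term \<open>1/2\<close> keeps \<open>e\<close> below 1, and the other term
    gives \<open>n * e \<le> \<delta>\<close>; the denominator \<open>n + 1\<close> also covers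
    \<open>n = 0\<close>.\<close>
  define e where "e = min (1/2) (\<delta> / (n + 1))"
  have e: "0 < e" "e < 1" using \<open>\<delta> > 0\<close> by (auto simp: e_def)
  have "n * e \<le> n * (\<delta> / (n + 1))" unfolding e_def by (intro mult_left_mono) auto
  also have "\<dots> \<le> \<delta>" using \<open>\<delta> > 0\<close> by (simp add: field_simps)
  finally have "n * e \<le> \<delta>" .
  moreover have "n * (lam * e) \<le> n * e"
    using assms e by (intro mult_left_mono mult_left_le_one_le) auto
  ultimately have small: "n * (lam * e) \<le> \<delta>" by linarith
  let ?S = "\<Pi>\<^sub>M j\<in>{1..n}. observation_space k"
  define D where "D = hidden_bid_model lam"
  define A where "A a = {w \<in> space ?S. tuple_kolmogorov_dist k (mu w) (D a) \<le> 1/4}" for a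
  have D_unit: "D a i \<in> space unit_distributions" if "a \<in> {0..1}" for a i
    unfolding D_def hidden_bid_model_def
    using assms that by (intro bid_dist_in_unit_distributions) auto
  have D_cdf: "lam * \<bar>x - y\<bar> \<le> \<bar>cdf (D a i) x - cdf (D a i) y\<bar>"
    if "x \<in> {0..1}" "y \<in> {0..1}" for a i x y
  proof (cases "x \<le> y")
    case True
    with that assms cdf_bid_dist_diff[of lam x y "if i = 1 then a else 1"]
    show ?thesis unfolding D_def hidden_bid_model_def by simp
  next
    case False
    with that assms cdf_bid_dist_diff[of lam y x "if i = 1 then a else 1"]
    show ?thesis unfolding D_def hidden_bid_model_def by simp
  qed
  have prob_eq: "\<P>(w in auction_samples k n (D a). tuple_kolmogorov_dist k (mu w) (D a) \<le> 1/4) =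
      measure (auction_samples k n (D a)) (A a)"
    and sets_eq: "sets (auction_samples k n (D a)) = sets ?S" for a
  proof -
    show "sets (auction_samples k n (D a)) = sets ?S"
      unfolding D_def using assms by (subst auction_samples_hidden_bid_model) auto
    then have "space (auction_samples k n (D a)) = space ?S"
      by (rule sets_eq_imp_space_eq)
    then show "\<P>(w in auction_samples k n (D a). tuple_kolmogorov_dist k (mu w) (D a) \<le> 1/4) =
      measure (auction_samples k n (D a)) (A a)"
      by (simp add: A_def)
  qed
  \<comment> \<open>An estimate close to both models would have a first CDF whose value at 0 is
    within \<open>1/4\<close> of two numbers at least \<open>1 - lam\<close> apart, and
    \<open>1 - lam > 1/2\<close>.\<close>
  have disj: "A 0 \<inter> A e = {}"
  proof (rule ccontr)
    assume "A 0 \<inter> A e \<noteq> {}"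
    then obtain w where w: "w \<in> space ?S" "tuple_kolmogorov_dist k (mu w) (D 0) \<le> 1/4"
        "tuple_kolmogorov_dist k (mu w) (D e) \<le> 1/4"
      by (auto simp: A_def)
    have "mu w 1 \<in> space unit_distributions"
      using measurable_space[OF assms(4)[unfolded estimators_def] w(1)] assms(1)
      by (auto simp: space_PiM)
    then have near: "\<bar>cdf (mu w 1) 0 - cdf (D a 1) 0\<bar> \<le> tuple_kolmogorov_dist k (mu w) (D a)"
      if "a \<in> {0..1}" for a
      using assms(1) that by (intro cdf_diff_le_tuple_kolmogorov_dist D_unit) auto
    have "1 - lam \<le> cdf (D 0 1) 0 - cdf (D e 1) 0"
      using cdf_bid_dist_point_mass[of lam e] assms e
      by (simp add: D_def hidden_bid_model_def)
    with near[of 0] near[of e] w e assms show False by auto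
  qed
  \<comment> \<open>Two success probabilities with sum at most \<open>1 + \<delta>\<close> cannot
    both exceed \<open>1/2 + \<delta>\<close>. Measurability of the success events is treated by
    cases instead of being derived from that of \<open>mu\<close>.\<close>
  have "\<exists>a\<in>{0, e}. measure (auction_samples k n (D a)) (A a) \<le> 1/2 + \<delta>"
  proof (cases "A 0 \<in> sets ?S \<and> A e \<in> sets ?S")
    case True
    with assms e disj have "measure (auction_samples k n (D 0)) (A 0) +
        measure (auction_samples k n (D e)) (A e) \<le> 1 + n * (lam * e)"
      unfolding D_def by (intro auction_success_sum) auto
    with small \<open>\<delta> > 0\<close> show ?thesis by auto
  next
    \<comment> \<open>\<^const>\<open>measure\<close> is 0 on non-measurable sets.\<close>
    case False
    then have "\<exists>a\<in>{0, e}. measure (auction_samples k n (D a)) (A a) = 0"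
      by (auto simp: sets_eq intro: measure_notin_sets)
    with \<open>\<delta> > 0\<close> show ?thesis by auto
  qed
  then obtain a where a: "a \<in> {0, e}" "measure (auction_samples k n (D a)) (A a) \<le> 1/2 + \<delta>"
    by blast
  then have "a \<in> {0..1}" using e by auto
  with a D_unit D_cdf show "\<exists>D :: nat \<Rightarrow> real measure.
       (\<forall>i\<in>{1..k}. D i \<in> space unit_distributions) \<and>
       (\<forall>i\<in>{1..k}. \<forall>x\<in>{0..1}. \<forall>y\<in>{0..1}.
          \<bar>cdf (D i) x - cdf (D i) y\<bar> \<ge> lam * \<bar>x - y\<bar>) \<and>
       \<P>(w in auction_samples k n D. tuple_kolmogorov_dist k (mu w) D \<le> 1/4) \<le> 1/2 + \<delta>"
    by (intro exI[of _ "D a"] conjI ballI) (simp_all only: prob_eq)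
qed

end
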